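(* Let $p\in(0,\infty)$, let $x\in\Sigma$ be simply normal, and let $\Lambda_1,\Lambda_2:\mathbb N\to(0,\infty)$ be the functions associated with $p$ and $x$. Then there are $c_1,c_2,d_1,d_2>0$ such that, for all $n\in\mathbb N$, $$c_1\Lambda_1(n)\le\sum_{k=1}^n\frac1{f^{k-1}(x)^p}\le c_2\Lambda_1(n)$$ and $$d_1\Lambda_2(n)\le\frac1n\left(\sum_{k=1}^n\frac1{f^{k-1}(x)^p}\right)\le d_2\Lambda_2(n).$$
   Context: $\mathbb N=\{1,2,3,\dots\}$. The map $f:[0,1)\to[0,1)$ is $f(x)=2x$ if $0\le x<1/2$ and $f(x)=2x-1$ if $1/2\le x<1$; $f^k$ is the $k$-fold composition, $f^0(x)=x$. $\Sigma$ is the set of $x\in[0,1)$ that are not binary rationals (a binary rational is $0$ or a number $k/2^n$ with $k,n\in\mathbb N$, $1\le k<2^n$). Each $x\in\Sigma$ has a unique binary expansion $x=\sum_{k\ge1}d_k/2^k$, $d_k\in\{0,1\}$, and its digits are neither eventually all $0$ nor eventually all $1$. $x\in\Sigma$ is simply normal (to base 2) if $\lim_{n\to\infty}\frac1n|\{k:1\le k\le n,\ d_k=0\}|=\frac12$ and $\lim_{n\to\infty}\frac1n|\{k:1\le k\le n,\ d_k=1\}|=\frac12$. Block decomposition: for $x\in\Sigma$ the digit sequence $d_1d_2d_3\dots$ is written uniquely as juxtaposed finite blocks $C_0B_1C_1B_2C_2\cdots$, where each $B_j$ ($j\ge1$) is a non-empty block of zeros, each $C_j$ ($j\ge1$) is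 a non-empty block of ones, and $C_0$ is a (possibly empty) block of ones. Let $\ell_j\ge1$ be the length of $B_j$ ($j\ge1$) and $m_j$ the length of $C_j$ ($j\ge0$). Let $J_j\subset\mathbb N$ be the set of positions occupied by $B_j$ and $K_j$ the set of positions occupied by $C_j$: with $s_0=0$, $t_0=m_0$, $s_j=t_{j-1}+\ell_j$, $t_j=s_j+m_j$ for $j\ge1$, one has $J_j=\{t_{j-1}+1,\dots,s_j\}$ for $j\ge 1$ and $K_j=\{s_j+1,\dots,t_j\}$ for $j\ge0$ ($K_0=\emptyset$ if $C_0$ is empty). The sets $K_0,J_1,K_1,J_2,K_2,\dots$ partition $\mathbb N$. Definition of $\Lambda_1,\Lambda_2$: $\Lambda_1(n)=\Lambda_2(n)=1$ if $n\in K_0$; if $n\in J_j\cup K_j$ with $j\ge1$, $$\Lambda_1(n)=\sum_{u=1}^j2^{p\ell_u},\qquad\Lambda_2(n)=\frac{\sum_{u=1}^j2^{p\ell_u}}{\sum_{u=1}^j\ell_u}.$$ *)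

theory Defs
  imports "HOL-Analysis.Analysis"
begin

text \<open>Only the values on \<open>[0,1)\<close> are relevant; this interval is mapped into itself.\<close>

definition doubling_map :: "real \<Rightarrow> real" where
  "doubling_map x = (if x < 1/2 then 2 * x else 2 * x - 1)"

lemma doubling_map_unit_interval: "x \<in> {0..<1} \<Longrightarrow> doubling_map x \<in> {0..<1}"
  by (auto simp: doubling_map_def)

definition binary_rational :: "real \<Rightarrow> bool" where
  "binary_rational x \<longleftrightarrow>
     x = 0 \<or> (\<exists>k n :: nat. 1 \<le> n \<and> 1 \<le> k \<and> k < 2 ^ n \<and> x = real k / 2 ^ n)"

definition nondyadic :: "real set" where
  "nondyadic = {x \<in> {0..<1}. \<not> binary_rational x}"

subsection \<open>Binary expansions\<close>

text \<open>Digits are indexed from \<open>1\<close>; the unused value at \<open>0\<close> is fixed so that expansions of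
  elements of \<^term>\<open>nondyadic\<close> are unique as functions.\<close>

definition is_binary_expansion :: "(nat \<Rightarrow> nat) \<Rightarrow> real \<Rightarrow> bool" where
  "is_binary_expansion d x \<longleftrightarrow>
     d 0 = 0 \<and> (\<forall>k\<ge>1. d k \<in> {0, 1}) \<and> (\<lambda>k. real (d (Suc k)) / 2 ^ Suc k) sums x"

definition digit :: "real \<Rightarrow> nat \<Rightarrow> nat" where
  "digit x = (THE d. is_binary_expansion d x)"

definition simply_normal :: "real \<Rightarrow> bool" where
  "simply_normal x \<longleftrightarrow>
     (\<lambda>n. real (card {k. 1 \<le> k \<and> k \<le> n \<and> digit x k = 0}) / real n) \<longlonglongrightarrow> 1/2 \<and>
     (\<lambda>n. real (card {k. 1 \<le> k \<and> k \<le> n \<and> digit x k = 1}) / real n) \<longlonglongrightarrow> 1/2"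

subsection \<open>Block decompositions\<close>

text \<open>Here \<open>l j\<close> is the length of the block of zeros \<open>B\<^sub>j\<close> (\<open>j \<ge> 1\<close>) and \<open>m j\<close> the length of the
  block of ones \<open>C\<^sub>j\<close> (\<open>j \<ge> 0\<close>); \<open>l 0\<close> is unused and fixed to be \<open>0\<close>.\<close>

fun s_pos t_pos :: "(nat \<Rightarrow> nat) \<Rightarrow> (nat \<Rightarrow> nat) \<Rightarrow> nat \<Rightarrow> nat" where
  "s_pos l m 0 = 0"
| "s_pos l m (Suc j) = t_pos l m j + l (Suc j)"
| "t_pos l m 0 = m 0"
| "t_pos l m (Suc j) = s_pos l m (Suc j) + m (Suc j)"

definition J_block :: "(nat \<Rightarrow> nat) \<Rightarrow> (nat \<Rightarrow> nat) \<Rightarrow> nat \<Rightarrow> nat set" where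
  "J_block l m j = {t_pos l m (j - 1) + 1 .. s_pos l m j}"

definition K_block :: "(nat \<Rightarrow> nat) \<Rightarrow> (nat \<Rightarrow> nat) \<Rightarrow> nat \<Rightarrow> nat set" where
  "K_block l m j = {s_pos l m j + 1 .. t_pos l m j}"

definition is_block_decomposition ::
    "(nat \<Rightarrow> nat) \<Rightarrow> (nat \<Rightarrow> nat) \<times> (nat \<Rightarrow> nat) \<Rightarrow> bool" where
  "is_block_decomposition d = (\<lambda>(l, m).
     l 0 = 0 \<and>
     (\<forall>j\<ge>1. 1 \<le> l j \<and> 1 \<le> m j) \<and>
     (\<forall>j\<ge>1. \<forall>k\<in>J_block l m j. d k = 0) \<and>
     (\<forall>j. \<forall>k\<in>K_block l m j. d k = 1))"

definition block_lengths :: "real \<Rightarrow> (nat \<Rightarrow> nat) \<times> (nat \<Rightarrow> nat)" where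
  "block_lengths x = (THE lm. is_block_decomposition (digit x) lm)"

definition zeros_length :: "real \<Rightarrow> nat \<Rightarrow> nat" where
  "zeros_length x = fst (block_lengths x)"

definition ones_length :: "real \<Rightarrow> nat \<Rightarrow> nat" where
  "ones_length x = snd (block_lengths x)"

definition J_set :: "real \<Rightarrow> nat \<Rightarrow> nat set" where
  "J_set x j = J_block (zeros_length x) (ones_length x) j"

definition K_set :: "real \<Rightarrow> nat \<Rightarrow> nat set" where
  "K_set x j = K_block (zeros_length x) (ones_length x) j"

definition block_index :: "real \<Rightarrow> nat \<Rightarrow> nat" where
  "block_index x n = (THE j. 1 \<le> j \<and> n \<in> J_set x j \<union> K_set x j)"

text \<open>The values at \<open>n = 0\<close> are irrelevant.\<close>

definition Lambda1 :: "real \<Rightarrow> real \<Rightarrow> nat \<Rightarrow> real" where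
  "Lambda1 p x n =
     (if n \<in> K_set x 0 then 1
      else (\<Sum>u = 1..block_index x n. 2 powr (p * real (zeros_length x u))))"

definition Lambda2 :: "real \<Rightarrow> real \<Rightarrow> nat \<Rightarrow> real" where
  "Lambda2 p x n =
     (if n \<in> K_set x 0 then 1
      else (\<Sum>u = 1..block_index x n. 2 powr (p * real (zeros_length x u))) /
           (\<Sum>u = 1..block_index x n. real (zeros_length x u)))"

subsection \<open>The definite descriptions above are well defined\<close>

definition dyadic_part :: "(nat \<Rightarrow> nat) \<Rightarrow> nat \<Rightarrow> nat" where
  "dyadic_part d n = (\<Sum>k<n. d (Suc k) * 2 ^ (n - Suc k))"

lemma dyadic_part_0: "dyadic_part d 0 = 0"
  by (simp add: dyadic_part_def)

lemma dyadic_part_Suc: "dyadic_part d (Suc n) = 2 * dyadic_part d n + d (Suc n)"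
proof -
  have "(\<Sum>k<n. d (Suc k) * 2 ^ (Suc n - Suc k)) = (\<Sum>k<n. 2 * (d (Suc k) * 2 ^ (n - Suc k)))"
  proof (rule sum.cong)
    fix k assume "k \<in> {..<n}"
    then have "Suc n - Suc k = Suc (n - Suc k)" by auto
    then show "d (Suc k) * 2 ^ (Suc n - Suc k) = 2 * (d (Suc k) * 2 ^ (n - Suc k))"
      by simp
  qed simp
  then show ?thesis by (simp add: dyadic_part_def sum_distrib_left)
qed

lemma sum_dyadic_part:
  "(\<Sum>k<n. real (d (Suc k)) / 2 ^ Suc k) = real (dyadic_part d n) / 2 ^ n"
  by (induction n) (auto simp: dyadic_part_0 dyadic_part_Suc field_simps)

lemma dyadic_int_binary_rational:
  fixes x :: real
  assumes "0 \<le> x" "x < 1" "x = real k / 2 ^ n"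
  shows "binary_rational x"
proof (cases "x = 0")
  case False
  with assms have k: "1 \<le> k" by (cases k) auto
  have "real k < 2 ^ n" using assms by (simp add: field_simps)
  then have k2: "k < 2 ^ n" by (metis of_nat_less_iff of_nat_numeral of_nat_power)
  with k have "1 \<le> n" by (cases n) auto
  with k k2 assms(3) show ?thesis by (auto simp: binary_rational_def)
qed (simp add: binary_rational_def)

lemma floor_power_less:
  fixes x :: real
  assumes "x \<in> nondyadic"
  shows "real (nat \<lfloor>2 ^ n * x\<rfloor>) < 2 ^ n * x" "2 ^ n * x < real (nat \<lfloor>2 ^ n * x\<rfloor>) + 1"
proof -
  have x: "0 \<le> x" "x < 1" "\<not> binary_rational x" using assms by (auto simp: nondyadic_def)
  have f: "real (nat \<lfloor>2 ^ n * x\<rfloor>) = of_int \<lfloor>2 ^ n * x\<rfloor>" using x by (simp add: of_nat_nat)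
  have "real (nat \<lfloor>2 ^ n * x\<rfloor>) \<le> 2 ^ n * x" unfolding f by simp
  moreover have "real (nat \<lfloor>2 ^ n * x\<rfloor>) \<noteq> 2 ^ n * x"
    using dyadic_int_binary_rational[OF x(1,2), of "nat \<lfloor>2 ^ n * x\<rfloor>" n] x(3)
    by (auto simp: field_simps)
  ultimately show "real (nat \<lfloor>2 ^ n * x\<rfloor>) < 2 ^ n * x" by linarith
  show "2 ^ n * x < real (nat \<lfloor>2 ^ n * x\<rfloor>) + 1" unfolding f by linarith
qed

lemma expansion_dyadic_part:
  assumes x: "x \<in> nondyadic" and d: "is_binary_expansion d x"
  shows "real (dyadic_part d n) < 2 ^ n * x" "2 ^ n * x < real (dyadic_part d n) + 1"
proof -
  have x': "0 \<le> x" "x < 1" "\<not> binary_rational x" using x by (auto simp: nondyadic_def)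
  let ?f = "\<lambda>k. real (d (Suc k)) / 2 ^ Suc k"
  have sm: "?f sums x" using d by (simp add: is_binary_expansion_def)
  have d01: "d (Suc k) \<le> 1" for k
  proof -
    have "d (Suc k) \<in> {0, 1}" using d unfolding is_binary_expansion_def by simp
    then show ?thesis by auto
  qed
  have tail: "(\<lambda>k. ?f (k + n)) sums (x - (\<Sum>k<n. ?f k))"
    using sm by (rule sums_split_initial_segment)
  have g: "(\<lambda>k. (1/2) ^ n * ((1/2) ^ Suc k)) sums ((1/2::real) ^ n * 1)"
    by (intro sums_mult power_half_series)
  have le: "x - (\<Sum>k<n. ?f k) \<le> (1/2) ^ n * 1"
  proof (rule sums_le[OF _ tail g])
    fix k
    show "?f (k + n) \<le> (1/2) ^ n * ((1/2) ^ Suc k)"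
      using d01[of "k + n"] by (simp add: field_simps power_add)
  qed
  have ge: "0 \<le> x - (\<Sum>k<n. ?f k)"
    by (rule sums_le[OF _ sums_zero tail]) simp
  have 1: "real (dyadic_part d n) \<le> 2 ^ n * x" "2 ^ n * x \<le> real (dyadic_part d n) + 1"
  proof -
    have "x \<le> (real (dyadic_part d n) + 1) / 2 ^ n"
      using le unfolding sum_dyadic_part by (simp add: power_one_over add_divide_distrib)
    then show "2 ^ n * x \<le> real (dyadic_part d n) + 1"
      by (simp add: pos_le_divide_eq mult.commute)
    have "real (dyadic_part d n) / 2 ^ n \<le> x" using ge unfolding sum_dyadic_part by simp
    then show "real (dyadic_part d n) \<le> 2 ^ n * x"
      by (simp add: pos_divide_le_eq mult.commute)
  qed
  have 2: "2 ^ n * x \<noteq> real k" for k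
    using dyadic_int_binary_rational[OF x'(1,2), of k n] x'(3) by (auto simp: field_simps)
  show "real (dyadic_part d n) < 2 ^ n * x" using 1(1) 2[of "dyadic_part d n"] by linarith
  show "2 ^ n * x < real (dyadic_part d n) + 1" using 1(2) 2[of "dyadic_part d n + 1"] by simp
qed

lemma ex1_binary_expansion:
  assumes x: "x \<in> nondyadic"
  shows "\<exists>!d. is_binary_expansion d x"
proof (rule ex_ex1I)
  define F where "F = (\<lambda>n. nat \<lfloor>2 ^ n * x\<rfloor>)"
  have F: "real (F n) < 2 ^ n * x" "2 ^ n * x < real (F n) + 1" for n
    using floor_power_less[OF x, of n] by (auto simp: F_def)
  have F0: "F 0 = 0" using x by (auto simp: F_def nondyadic_def)
  have step: "2 * F n \<le> F (Suc n) \<and> F (Suc n) \<le> 2 * F n + 1" for n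
  proof -
    have "real (2 * F n) < real (F (Suc n) + 1)" "real (F (Suc n)) < real (2 * F n + 2)"
      using F[of n] F[of "Suc n"] by simp_all
    then show ?thesis unfolding of_nat_less_iff by linarith
  qed
  define d where "d = (\<lambda>k. if k = 0 then 0 else F k - 2 * F (k - 1))"
  have dS: "d (Suc k) + 2 * F k = F (Suc k)" "d (Suc k) \<le> 1" for k
    using step[of k] by (auto simp: d_def)
  have dp: "dyadic_part d n = F n" for n
  proof (induction n)
    case (Suc n)
    then show ?case using dS(1)[of n] by (simp add: dyadic_part_Suc)
  qed (simp add: F0 dyadic_part_0)
  have "(\<lambda>n. real (F n) / 2 ^ n) \<longlonglongrightarrow> x"
  proof (rule tendsto_sandwich[where f = "\<lambda>n. x - (1/2) ^ n" and h = "\<lambda>n. x"])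
    show "\<forall>\<^sub>F n in sequentially. x - (1/2) ^ n \<le> real (F n) / 2 ^ n"
    proof (intro always_eventually allI)
      fix n
      have "x \<le> (real (F n) + 1) / 2 ^ n"
        using F(2)[of n] by (simp add: pos_le_divide_eq mult.commute less_imp_le)
      then show "x - (1/2) ^ n \<le> real (F n) / 2 ^ n"
        by (simp add: power_one_over add_divide_distrib)
    qed
    show "\<forall>\<^sub>F n in sequentially. real (F n) / 2 ^ n \<le> x"
    proof (intro always_eventually allI)
      fix n
      show "real (F n) / 2 ^ n \<le> x" using F(1)[of n] by (simp add: field_simps)
    qed
    have "(\<lambda>n. x - (1/2) ^ n) \<longlonglongrightarrow> x - 0"
      by (intro tendsto_intros LIMSEQ_power_zero) auto
    then show "(\<lambda>n. x - (1/2) ^ n) \<longlonglongrightarrow> x" by simp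
  qed simp
  then have "(\<lambda>k. real (d (Suc k)) / 2 ^ Suc k) sums x"
    unfolding sums_def sum_dyadic_part dp .
  moreover have "d k \<in> {0, 1}" if "1 \<le> k" for k
    using dS(2)[of "k - 1"] that by (cases "d k") auto
  ultimately show "\<exists>d. is_binary_expansion d x"
    by (intro exI[of _ d]) (simp add: is_binary_expansion_def d_def)
next
  fix d e assume d: "is_binary_expansion d x" and e: "is_binary_expansion e x"
  have eq: "dyadic_part d n = dyadic_part e n" for n
    using expansion_dyadic_part[OF x d, of n] expansion_dyadic_part[OF x e, of n] by linarith
  show "d = e"
  proof
    fix k show "d k = e k"
    proof (cases k)
      case 0 then show ?thesis using d e by (simp add: is_binary_expansion_def)
    next
      case (Suc n)
      then show ?thesis using eq[of n] eq[of "Suc n"] by (simp add: dyadic_part_Suc)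
    qed
  qed
qed

lemma digit_expansion: "x \<in> nondyadic \<Longrightarrow> is_binary_expansion (digit x) x"
  unfolding digit_def by (rule theI'[OF ex1_binary_expansion])

lemma digit_in: "x \<in> nondyadic \<Longrightarrow> digit x (Suc k) \<in> {0, 1}"
  using digit_expansion[of x] by (auto simp: is_binary_expansion_def)

lemma digit_not_eventually_const:
  assumes x: "x \<in> nondyadic" and c: "c \<in> {0, 1}"
  shows "\<exists>k\<ge>N. digit x (Suc k) = c"
proof (rule ccontr)
  assume "\<not> ?thesis"
  then have d: "digit x (Suc k) = 1 - c" if "k \<ge> N" for k
    using digit_in[OF x, of k] c that by fastforce
  have x': "0 \<le> x" "x < 1" "\<not> binary_rational x" using x by (auto simp: nondyadic_def)
  let ?f = "\<lambda>k. real (digit x (Suc k)) / 2 ^ Suc k"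
  have "?f sums x" using digit_expansion[OF x] by (simp add: is_binary_expansion_def)
  then have tail: "(\<lambda>k. ?f (k + N)) sums (x - (\<Sum>k<N. ?f k))"
    by (rule sums_split_initial_segment)
  have "(\<lambda>k. (1 - real c) * (1/2) ^ N * ((1/2) ^ Suc k)) sums ((1 - real c) * (1/2::real) ^ N * 1)"
    by (intro sums_mult power_half_series)
  also have "(\<lambda>k. (1 - real c) * (1/2) ^ N * ((1/2) ^ Suc k)) = (\<lambda>k. ?f (k + N))"
    using c by (auto simp: d power_add field_simps)
  finally have "x - (\<Sum>k<N. ?f k) = (1 - real c) * (1/2) ^ N * 1"
    by (rule sums_unique2[OF tail])
  then have "x = real (dyadic_part (digit x) N + (1 - c)) / 2 ^ N"
    unfolding sum_dyadic_part using c by (auto simp: power_one_over add_divide_distrib)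
  with dyadic_int_binary_rational[OF x'(1,2)] x'(3) show False by blast
qed

lemma ex1_block_decomposition:
  assumes x: "x \<in> nondyadic"
  shows "\<exists>!lm. is_block_decomposition (digit x) lm"
proof (rule ex_ex1I)
  define T where "T = (\<lambda>s. LEAST k. s \<le> k \<and> digit x (Suc k) = 0)"
  define S where "S = (\<lambda>t. LEAST k. t \<le> k \<and> digit x (Suc k) = 1)"
  have T: "s \<le> T s" "digit x (Suc (T s)) = 0" for s
    using LeastI_ex[of "\<lambda>k. s \<le> k \<and> digit x (Suc k) = 0"]
      digit_not_eventually_const[OF x, of 0 s] by (auto simp: T_def)
  have S: "s \<le> S s" "digit x (Suc (S s)) = 1" for s
    using LeastI_ex[of "\<lambda>k. s \<le> k \<and> digit x (Suc k) = 1"]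
      digit_not_eventually_const[OF x, of 1 s] by (auto simp: S_def)
  have Tl: "digit x (Suc k) = 1" if "s \<le> k" "k < T s" for s k
    using not_less_Least[of k "\<lambda>k. s \<le> k \<and> digit x (Suc k) = 0"] that digit_in[OF x, of k]
    by (auto simp: T_def)
  have Sl: "digit x (Suc k) = 0" if "s \<le> k" "k < S s" for s k
    using not_less_Least[of k "\<lambda>k. s \<le> k \<and> digit x (Suc k) = 1"] that digit_in[OF x, of k]
    by (auto simp: S_def)
  define a where "a = rec_nat 0 (\<lambda>_ s. S (T s))"
  have a0: "a 0 = 0" and aS: "a (Suc j) = S (T (a j))" for j by (simp_all add: a_def)
  define m where "m = (\<lambda>j. T (a j) - a j)"
  define l where "l = (\<lambda>j. if j = 0 then 0 else a j - T (a (j - 1)))"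
  have st: "s_pos l m j = a j \<and> t_pos l m j = T (a j)" for j
  proof (induction j)
    case (Suc j)
    then show ?case using T(1)[of "a (Suc j)"] S(1)[of "T (a j)"] by (simp add: l_def m_def aS)
  qed (use T(1)[of 0] in \<open>simp add: a0 m_def\<close>)
  have "is_block_decomposition (digit x) (l, m)"
    unfolding is_block_decomposition_def prod.case
  proof (intro conjI allI impI ballI)
    fix j :: nat assume "1 \<le> j"
    then obtain i where j: "j = Suc i" by (cases j) auto
    have "T (a i) \<noteq> S (T (a i))" using T(2)[of "a i"] S(2)[of "T (a i)"] by auto
    then show "1 \<le> l j" using S(1)[of "T (a i)"] by (simp add: l_def j aS)
    have "a j \<noteq> T (a j)" using T(2)[of "a j"] S(2)[of "T (a i)"] unfolding j aS by auto
    then show "1 \<le> m j" using T(1)[of "a j"] by (simp add: m_def)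
    fix k assume "k \<in> J_block l m j"
    then show "digit x k = 0" using Sl[of "T (a i)" "k - 1"] by (auto simp: J_block_def st j aS simp del: s_pos.simps t_pos.simps)
  next
    fix j k assume "k \<in> K_block l m j"
    then show "digit x k = 1" using Tl[of "a j" "k - 1"] by (auto simp: K_block_def st simp del: s_pos.simps t_pos.simps)
  qed (simp add: l_def)
  then show "\<exists>lm. is_block_decomposition (digit x) lm" by blast
next
  have step: "t_pos l m j \<ge> t_pos l' m' j"
    if "is_block_decomposition (digit x) (l, m)" "is_block_decomposition (digit x) (l', m')"
      "s_pos l m j = s_pos l' m' j" for l m l' m' j
  proof (rule ccontr)
    assume "\<not> ?thesis"
    moreover have "s_pos l m j \<le> t_pos l m j" by (cases j) auto
    ultimately have "Suc (t_pos l m j) \<in> K_block l' m' j"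
      using that(3) by (auto simp: K_block_def)
    then have "digit x (Suc (t_pos l m j)) = 1"
      using that(2) by (auto simp: is_block_decomposition_def)
    moreover have "1 \<le> l (Suc j)" using that(1) by (auto simp: is_block_decomposition_def)
    then have "Suc (t_pos l m j) \<in> J_block l m (Suc j)" by (auto simp: J_block_def)
    then have "digit x (Suc (t_pos l m j)) = 0"
      using that(1) by (auto simp: is_block_decomposition_def)
    ultimately show False by simp
  qed
  have step2: "s_pos l m (Suc j) \<ge> s_pos l' m' (Suc j)"
    if "is_block_decomposition (digit x) (l, m)" "is_block_decomposition (digit x) (l', m')"
      "t_pos l m j = t_pos l' m' j" for l m l' m' j
  proof (rule ccontr)
    assume "\<not> ?thesis"
    then have "Suc (s_pos l m (Suc j)) \<in> J_block l' m' (Suc j)"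
      using that(3) by (auto simp: J_block_def)
    then have "digit x (Suc (s_pos l m (Suc j))) = 0"
      using that(2) by (auto simp: is_block_decomposition_def)
    moreover have "1 \<le> m (Suc j)" using that(1) by (auto simp: is_block_decomposition_def)
    then have "Suc (s_pos l m (Suc j)) \<in> K_block l m (Suc j)" by (auto simp: K_block_def)
    then have "digit x (Suc (s_pos l m (Suc j))) = 1"
      using that(1) by (auto simp: is_block_decomposition_def)
    ultimately show False by simp
  qed
  fix lm lm' assume "is_block_decomposition (digit x) lm" "is_block_decomposition (digit x) lm'"
  moreover obtain l m l' m' where lm: "lm = (l, m)" "lm' = (l', m')" by fastforce
  ultimately have A: "is_block_decomposition (digit x) (l, m)"
    "is_block_decomposition (digit x) (l', m')" by simp_all
  have eq: "s_pos l m j = s_pos l' m' j \<and> t_pos l m j = t_pos l' m' j" for j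
  proof (induction j)
    case 0
    show ?case using step[OF A, of 0] step[OF A(2,1), of 0] by simp
  next
    case (Suc j)
    then have "s_pos l m (Suc j) = s_pos l' m' (Suc j)"
      using step2[OF A, of j] step2[OF A(2,1), of j] by linarith
    then show ?case using step[OF A, of "Suc j"] step[OF A(2,1), of "Suc j"] by linarith
  qed
  have "l j = l' j" for j
    using A eq[of "j - 1"] eq[of j] by (cases j) (auto simp: is_block_decomposition_def)
  moreover have "m j = m' j" for j using eq[of j] by (cases j) auto
  ultimately show "lm = lm'" by (auto simp: lm)
qed

lemma block_lengths_decomposition:
  assumes "x \<in> nondyadic"
  shows "is_block_decomposition (digit x) (zeros_length x, ones_length x)"
  using theI'[OF ex1_block_decomposition[OF assms]]
  by (simp add: zeros_length_def ones_length_def block_lengths_def)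

lemma ex1_block_index:
  assumes x: "x \<in> nondyadic" and n: "1 \<le> n" "n \<notin> K_set x 0"
  shows "\<exists>!j. 1 \<le> j \<and> n \<in> J_set x j \<union> K_set x j"
proof -
  let ?t = "t_pos (zeros_length x) (ones_length x)"
  have B: "1 \<le> zeros_length x j" "1 \<le> ones_length x j" if "1 \<le> j" for j
    using block_lengths_decomposition[OF x] that by (auto simp: is_block_decomposition_def)
  have U: "J_set x (Suc i) \<union> K_set x (Suc i) = {?t i <.. ?t (Suc i)}" for i
    by (auto simp: J_set_def K_set_def J_block_def K_block_def)
  have lt: "?t i < ?t (Suc i)" for i using B[of "Suc i"] by simp
  then have sm: "strict_mono ?t" by (simp add: strict_mono_Suc_iff)
  have "n \<le> ?t n" by (rule strict_mono_imp_increasing[OF sm])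
  define j where "j = (LEAST j. n \<le> ?t j)"
  have j: "n \<le> ?t j" unfolding j_def by (rule LeastI[of _ n]) fact
  have "j \<noteq> 0" by (rule notI) (use j n in \<open>simp add: K_set_def K_block_def\<close>)
  then obtain i where ji: "j = Suc i" by (cases j) auto
  have "\<not> n \<le> ?t i" using not_less_Least[of i "\<lambda>j. n \<le> ?t j"] ji by (auto simp: j_def)
  then have ex: "n \<in> J_set x j \<union> K_set x j" using j unfolding ji U by auto
  show ?thesis
  proof (rule ex1I[of _ j])
    show "1 \<le> j \<and> n \<in> J_set x j \<union> K_set x j" using ex ji by simp
    fix k assume k: "1 \<le> k \<and> n \<in> J_set x k \<union> K_set x k"
    then obtain h where h: "k = Suc h" by (cases k) auto
    have kt: "?t h < n" "n \<le> ?t (Suc h)" using k unfolding h U by auto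
    have "\<not> n \<le> ?t i" by fact
    then have "?t h < ?t (Suc i)" "?t i < ?t (Suc h)" using kt j ji by auto
    then have "h < Suc i" "i < Suc h" using strict_mono_less[OF sm] by blast+
    then show "k = j" by (simp add: h ji)
  qed
qed

end

(* Multiplying by 2 deletes a leading zero, so along a block of zeros the weight w k = (f^k x)^(-p)
   shrinks by exactly the factor q = 2^p at each step; hence the sum of w over a block of length l is
   comparable to its first term, which is q^l up to a factor of at most q. At a digit one, w lies
   between 1 and q. Thus the zeros contribute about Lambda1, and simple normality bounds the number of
   ones up to n linearly by the number of zeros, which is itself dominated by the contribution of the
   zeros. Simple normality also shows that n is comparable to the total length of the blocks of zeros
   started up to n, even if n lies inside a long block: the end of that block still has about as many
   ones, all of them before n, as zeros. This turns the first estimate into the second. *)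

theory Submission
  imports Defs
begin

section \<open>Orbit weights along the digits\<close>

definition orbit_weight :: "real \<Rightarrow> real \<Rightarrow> nat \<Rightarrow> real" where
  "orbit_weight p x k = 1 / ((doubling_map ^^ k) x) powr p"

definition digit_count :: "real \<Rightarrow> nat \<Rightarrow> nat \<Rightarrow> nat" where
  "digit_count x c n = card {k. 1 \<le> k \<and> k \<le> n \<and> digit x k = c}"

text \<open>These are s_j and t_j. With index \<open>k\<close> standing for the digit
  \<open>Suc k\<close>, which governs weight \<open>k\<close>, the zeros of B_(j+1) fill the
  half-open range from \<open>ones_end x j\<close> to \<open>zeros_end x (Suc j)\<close>, and the
  ones of C_j that from \<open>zeros_end x j\<close> to \<open>ones_end x j\<close>.\<close>

abbreviation zeros_end :: "real \<Rightarrow> nat \<Rightarrow> nat" where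
  "zeros_end x \<equiv> s_pos (zeros_length x) (ones_length x)"

abbreviation ones_end :: "real \<Rightarrow> nat \<Rightarrow> nat" where
  "ones_end x \<equiv> t_pos (zeros_length x) (ones_length x)"

text \<open>\<open>dyadic_part (digit x) n\<close> is the integer part of 2^n x, so the iterate is
  the fractional part.\<close>

lemma doubling_map_iterate:
  assumes x: "x \<in> nondyadic"
  shows "(doubling_map ^^ n) x = 2 ^ n * x - real (dyadic_part (digit x) n)"
proof (induction n)
  case 0
  show ?case by (simp add: dyadic_part_0)
next
  case (Suc n)
  \<comment> \<open>With the induction hypothesis this puts \<open>2 * (doubling_map ^^ n) x\<close>
    strictly between d and d + 1, where d is \<open>digit x (Suc n)\<close>; so d selects the branch
    of the map.\<close>
  have "real (dyadic_part (digit x) (Suc n)) < 2 ^ Suc n * x"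
    "2 ^ Suc n * x < real (dyadic_part (digit x) (Suc n)) + 1"
    using expansion_dyadic_part[OF x digit_expansion[OF x]] by blast+
  then show ?case
    using Suc digit_in[OF x, of n] by (auto simp: doubling_map_def dyadic_part_Suc)
qed

lemma doubling_map_iterate_bounds:
  assumes x: "x \<in> nondyadic"
  shows "0 < (doubling_map ^^ n) x" "(doubling_map ^^ n) x < 1"
  using expansion_dyadic_part[OF x digit_expansion[OF x], of n]
  by (simp_all add: doubling_map_iterate[OF x])

lemma doubling_map_iterate_Suc:
  assumes "x \<in> nondyadic"
  shows "(doubling_map ^^ Suc n) x = 2 * (doubling_map ^^ n) x - real (digit x (Suc n))"
  by (simp only: doubling_map_iterate[OF assms]) (simp add: dyadic_part_Suc)

lemma orbit_weight_ge_1: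
  assumes "x \<in> nondyadic" "0 < p"
  shows "1 \<le> orbit_weight p x n"
proof -
  have "(doubling_map ^^ n) x powr p \<le> 1"
    using doubling_map_iterate_bounds[OF assms(1), of n] assms(2) by (intro powr_le1) auto
  then show ?thesis
    using doubling_map_iterate_bounds[OF assms(1), of n] by (simp add: orbit_weight_def)
qed

lemma orbit_weight_one_digit:
  assumes x: "x \<in> nondyadic" and "0 < p" "digit x (Suc n) = 1"
  shows "orbit_weight p x n \<le> 2 powr p"
proof -
  let ?y = "(doubling_map ^^ n) x"
  \<comment> \<open>The next iterate is 2y - 1, and it is positive.\<close>
  have "1 < 2 * ?y"
    using doubling_map_iterate_bounds(1)[OF x, of "Suc n"] doubling_map_iterate_Suc[OF x, of n]
      assms(3) by simp
  then have "1 \<le> (2 * ?y) powr p" using assms(2) by (intro ge_one_powr_ge_zero) auto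
  then show ?thesis
    using doubling_map_iterate_bounds[OF x, of n]
    by (simp add: orbit_weight_def powr_mult field_simps)
qed

lemma orbit_weight_zero_digit:
  assumes x: "x \<in> nondyadic" and "digit x (Suc n) = 0"
  shows "orbit_weight p x n = 2 powr p * orbit_weight p x (Suc n)"
  using doubling_map_iterate_Suc[OF x, of n] assms(2) doubling_map_iterate_bounds[OF x, of n]
  by (simp add: orbit_weight_def powr_mult del: funpow.simps)

lemma orbit_weight_zero_run:
  assumes x: "x \<in> nondyadic" and "\<And>k. a \<le> k \<Longrightarrow> k < a + l \<Longrightarrow> digit x (Suc k) = 0"
  shows "orbit_weight p x a = (2 powr p) ^ l * orbit_weight p x (a + l)"
  using assms(2)
proof (induction l)
  case (Suc l)
  then show ?case using orbit_weight_zero_digit[OF x, of "a + l" p] by simp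
qed simp

text \<open>On zeros the weight satisfies \<open>(1 - 1 / q) w\<^sub>k = w\<^sub>k - w\<^bsub>k+1\<^esub>\<close>, so the sum telescopes.\<close>

lemma sum_orbit_weight_zero_run:
  assumes x: "x \<in> nondyadic" and "0 < p"
    and "\<And>k. a \<le> k \<Longrightarrow> k < a + l \<Longrightarrow> digit x (Suc k) = 0"
  shows "(\<Sum>k = a..<a + l. orbit_weight p x k) \<le> 2 powr p / (2 powr p - 1) * orbit_weight p x a"
proof -
  define q where "q = 2 powr p"
  have q: "1 < q" using \<open>0 < p\<close> by (simp add: q_def)
  have "(\<Sum>k = a..<a + l. orbit_weight p x k) =
      q / (q - 1) * (orbit_weight p x a - orbit_weight p x (a + l))"
    using assms(3)
  proof (induction l)
    case (Suc l)
    then have "orbit_weight p x (a + l) = q * orbit_weight p x (Suc (a + l))"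
      unfolding q_def by (intro orbit_weight_zero_digit[OF x]) auto
    then show ?case using Suc q by (simp add: field_simps)
  qed simp
  also have "\<dots> \<le> q / (q - 1) * orbit_weight p x a"
    using q orbit_weight_ge_1[OF x \<open>0 < p\<close>, of "a + l"] by (intro mult_left_mono) auto
  finally show ?thesis unfolding q_def .
qed

section \<open>Block structure and sums over blocks\<close>

lemma zeros_ones_length_pos:
  assumes "x \<in> nondyadic" "1 \<le> j"
  shows "1 \<le> zeros_length x j" "1 \<le> ones_length x j"
  using block_lengths_decomposition[OF assms(1)] assms(2)
  by (auto simp: is_block_decomposition_def)

lemma digit_zeros_block:
  assumes "x \<in> nondyadic" "ones_end x j \<le> k" "k < zeros_end x (Suc j)"
  shows "digit x (Suc k) = 0"
proof -
  have "Suc k \<in> J_block (zeros_length x) (ones_length x) (Suc j)"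
    using assms by (simp add: J_block_def)
  then show ?thesis
    using block_lengths_decomposition[OF assms(1)] unfolding is_block_decomposition_def by fastforce
qed

lemma digit_ones_block:
  assumes "x \<in> nondyadic" "zeros_end x j \<le> k" "k < ones_end x j"
  shows "digit x (Suc k) = 1"
proof -
  have "Suc k \<in> K_block (zeros_length x) (ones_length x) j"
    using assms by (simp add: K_block_def)
  then show ?thesis
    using block_lengths_decomposition[OF assms(1)] unfolding is_block_decomposition_def by fastforce
qed

text \<open>Index \<open>ones_end x j\<close> is the first zero of its block. The run of zeros ends
  at a digit one, whose weight lies between 1 and q = 2^p, and each zero contributes one factor
  q.\<close>

lemma orbit_weight_ones_end:
  assumes x: "x \<in> nondyadic" and p: "0 < p"
  shows "(2 powr p) ^ zeros_length x (Suc j) \<le> orbit_weight p x (ones_end x j)"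
    and "orbit_weight p x (ones_end x j) \<le> (2 powr p) ^ zeros_length x (Suc j) * 2 powr p"
proof -
  have eq: "orbit_weight p x (ones_end x j) =
      (2 powr p) ^ zeros_length x (Suc j) * orbit_weight p x (zeros_end x (Suc j))"
    using orbit_weight_zero_run[OF x, of "ones_end x j" "zeros_length x (Suc j)" p]
      digit_zeros_block[OF x, of j] by simp
  have "digit x (Suc (zeros_end x (Suc j))) = 1"
    using zeros_ones_length_pos(2)[OF x, of "Suc j"]
    by (intro digit_ones_block[OF x, of "Suc j"]) auto
  then show "orbit_weight p x (ones_end x j) \<le> (2 powr p) ^ zeros_length x (Suc j) * 2 powr p"
    unfolding eq using orbit_weight_one_digit[OF x p] by (intro mult_left_mono) auto
  show "(2 powr p) ^ zeros_length x (Suc j) \<le> orbit_weight p x (ones_end x j)"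
    unfolding eq using orbit_weight_ge_1[OF x p, of "zeros_end x (Suc j)"]
    by (simp add: mult_le_cancel_left1)
qed

lemma sum_lessThan_split:
  fixes g :: "nat \<Rightarrow> 'a::comm_monoid_add"
  assumes "a \<le> b"
  shows "sum g {..<b} = sum g {..<a} + sum g {a..<b}"
  using assms by (metis lessThan_atLeast0 sum.atLeastLessThan_concat zero_le)

text \<open>The weights of a block of zeros form a geometric sum, at most q/(q-1) times the first
  one, which is at most q^l q. Indices with digit one are masked out, so blocks of ones add
  nothing.\<close>

lemma sum_zeros_upper:
  assumes x: "x \<in> nondyadic" and p: "0 < p"
  shows "(\<Sum>k<ones_end x j. if digit x (Suc k) = 0 then orbit_weight p x k else 0)
    \<le> 2 powr p / (2 powr p - 1) * 2 powr p * (\<Sum>u = 1..j. (2 powr p) ^ zeros_length x u)"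
proof (induction j)
  case 0
  have "(\<Sum>k<ones_end x 0. if digit x (Suc k) = 0 then orbit_weight p x k else 0) = 0"
    using digit_ones_block[OF x, of 0] by (intro sum.neutral) auto
  then show ?case by simp
next
  case (Suc j)
  let ?q = "2 powr p" and ?g = "\<lambda>k. if digit x (Suc k) = 0 then orbit_weight p x k else 0"
  let ?s = "zeros_end x (Suc j)"
  have le: "ones_end x j \<le> ?s" "?s \<le> ones_end x (Suc j)" by simp_all
  have "sum ?g {ones_end x j..<?s} = (\<Sum>k = ones_end x j..<?s. orbit_weight p x k)"
    using digit_zeros_block[OF x, of j] by (intro sum.cong) auto
  also have "\<dots> \<le> ?q / (?q - 1) * orbit_weight p x (ones_end x j)"
    using sum_orbit_weight_zero_run[OF x p, of "ones_end x j" "zeros_length x (Suc j)"]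
      digit_zeros_block[OF x, of j] by simp
  also have "\<dots> \<le> ?q / (?q - 1) * (?q ^ zeros_length x (Suc j) * ?q)"
    using orbit_weight_ones_end(2)[OF x p] p
    by (intro mult_left_mono divide_nonneg_nonneg) (auto simp: ge_one_powr_ge_zero)
  finally have "sum ?g {ones_end x j..<?s} \<le> ?q / (?q - 1) * ?q * ?q ^ zeros_length x (Suc j)"
    by (simp add: mult_ac)
  moreover have "sum ?g {?s..<ones_end x (Suc j)} = 0"
    using digit_ones_block[OF x, of "Suc j"] by (intro sum.neutral) auto
  ultimately show ?case
    using Suc sum_lessThan_split[OF le(1), of ?g] sum_lessThan_split[OF le(2), of ?g]
    by (simp add: distrib_left del: s_pos.simps t_pos.simps)
qed

text \<open>Only the first weight of each block of zeros is kept. The sum stops right after the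
  first zero of block \<open>Suc j\<close>, so the bound serves every n from the start of that block
  on.\<close>

lemma sum_orbit_weight_lower:
  assumes x: "x \<in> nondyadic" and p: "0 < p"
  shows "(\<Sum>u = 1..Suc j. (2 powr p) ^ zeros_length x u) \<le> (\<Sum>k<Suc (ones_end x j). orbit_weight p x k)"
proof (induction j)
  case 0
  have "0 \<le> (\<Sum>k<ones_length x 0. orbit_weight p x k)"
    by (intro sum_nonneg) (simp add: orbit_weight_def)
  then show ?case using orbit_weight_ones_end(1)[OF x p, of 0] by simp
next
  case (Suc j)
  \<comment> \<open>Hence the first weight of the next block is a new term, outside the sum in the
    induction hypothesis.\<close>
  have "Suc (ones_end x j) \<le> ones_end x (Suc j)"
    using zeros_ones_length_pos(1)[OF x, of "Suc j"] by simp
  then have "(\<Sum>k<Suc (ones_end x j). orbit_weight p x k) \<le> (\<Sum>k<ones_end x (Suc j). orbit_weight p x k)"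
    by (intro sum_mono2) (auto simp: orbit_weight_def)
  then show ?case
    using Suc orbit_weight_ones_end(1)[OF x p, of "Suc j"] by (simp del: s_pos.simps t_pos.simps)
qed

section \<open>Digit counts, densities, and their use in bounding weight sums\<close>

lemma digit_count_eq_sum:
  "digit_count x c n = (\<Sum>k<n. if digit x (Suc k) = c then 1 else 0)"
proof -
  have "bij_betw Suc {k \<in> {..<n}. digit x (Suc k) = c} {k. 1 \<le> k \<and> k \<le> n \<and> digit x k = c}"
    by (rule bij_betw_byWitness[where f' = "\<lambda>k. k - 1"]) auto
  then have "digit_count x c n = card {k \<in> {..<n}. digit x (Suc k) = c}"
    unfolding digit_count_def by (rule bij_betw_same_card[symmetric])
  also have "\<dots> = (\<Sum>k<n. if digit x (Suc k) = c then 1 else 0)"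
    by (simp add: sum.If_cases Int_def)
  finally show ?thesis .
qed

lemma digit_count_le: "digit_count x c n \<le> n"
proof -
  have "digit_count x c n \<le> (\<Sum>k<n. 1)" unfolding digit_count_eq_sum by (intro sum_mono) auto
  then show ?thesis by simp
qed

lemma digit_count_mono: "a \<le> b \<Longrightarrow> digit_count x c a \<le> digit_count x c b"
  unfolding digit_count_eq_sum by (intro sum_mono2) auto

text \<open>This turns the denominator of \<open>Lambda2\<close> into a count of zeros, to which
  densities apply. A block of ones adds no zeros, so the count agrees at both of its ends.\<close>

lemma digit_count_zeros:
  assumes x: "x \<in> nondyadic"
  shows "digit_count x 0 (ones_end x j) = (\<Sum>u = 1..j. zeros_length x u)"
    and "digit_count x 0 (zeros_end x (Suc j)) = (\<Sum>u = 1..Suc j. zeros_length x u)"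
proof -
  let ?g = "\<lambda>k. if digit x (Suc k) = 0 then 1 else 0 :: nat"
  have s: "digit_count x 0 (zeros_end x (Suc j)) = digit_count x 0 (ones_end x j) + zeros_length x (Suc j)" for j
  proof -
    have "sum ?g {ones_end x j..<zeros_end x (Suc j)} = (\<Sum>k = ones_end x j..<zeros_end x (Suc j). 1)"
      using digit_zeros_block[OF x, of j] by (intro sum.cong) auto
    then show ?thesis
      using sum_lessThan_split[of "ones_end x j" "zeros_end x (Suc j)" ?g]
      by (simp add: digit_count_eq_sum)
  qed
  have t: "digit_count x 0 (ones_end x j) = digit_count x 0 (zeros_end x j)" for j
  proof -
    have "sum ?g {zeros_end x j..<ones_end x j} = 0"
      using digit_ones_block[OF x, of j] by (intro sum.neutral) auto
    moreover have "zeros_end x j \<le> ones_end x j" by (cases j) auto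
    ultimately show ?thesis
      using sum_lessThan_split[of "zeros_end x j" "ones_end x j" ?g]
      by (simp add: digit_count_eq_sum)
  qed
  show A: "digit_count x 0 (ones_end x j) = (\<Sum>u = 1..j. zeros_length x u)" for j
  proof (induction j)
    case 0
    show ?case by (simp only: t s_pos.simps) (simp add: digit_count_eq_sum)
  next
    case (Suc j)
    then show ?case by (simp only: t s) simp
  qed
  show "digit_count x 0 (zeros_end x (Suc j)) = (\<Sum>u = 1..Suc j. zeros_length x u)"
    by (simp only: s A) simp
qed

text \<open>A block of zeros adds no ones, so all ones counted at its end precede its start. This
  controls an n inside a long block of zeros.\<close>

lemma digit_count_ones:
  assumes x: "x \<in> nondyadic"
  shows "digit_count x 1 (zeros_end x (Suc j)) \<le> ones_end x j"
proof -
  let ?g = "\<lambda>k. if digit x (Suc k) = 1 then 1 else 0 :: nat"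
  have "sum ?g {ones_end x j..<zeros_end x (Suc j)} = 0"
    using digit_zeros_block[OF x, of j] by (intro sum.neutral) auto
  then have "digit_count x 1 (zeros_end x (Suc j)) = digit_count x 1 (ones_end x j)"
    using sum_lessThan_split[of "ones_end x j" "zeros_end x (Suc j)" ?g]
    by (simp add: digit_count_eq_sum)
  then show ?thesis using digit_count_le[of x 1 "ones_end x j"] by simp
qed

text \<open>The summand 1 absorbs the finitely many n at which the density is not yet effective, so
  the bound holds for every n.\<close>

lemma linear_bound_of_positive_density:
  fixes c :: "nat \<Rightarrow> nat"
  assumes "(\<lambda>n. real (c n) / real n) \<longlonglongrightarrow> \<delta>" "0 < \<delta>"
  shows "\<exists>A\<ge>1. \<forall>n. real n \<le> A * (1 + real (c n))"
proof -
  have "\<forall>\<^sub>F n in sequentially. \<delta> / 2 < real (c n) / real n"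
    using assms by (intro order_tendstoD(1)[OF assms(1)]) simp
  then obtain N where N: "\<delta> / 2 < real (c n) / real n" if "N \<le> n" for n
    by (auto simp: eventually_sequentially)
  \<comment> \<open>The term 2/\<delta> serves n \<ge> N, the term N serves n < N, and 1 gives the
    lower bound on \<open>A\<close>.\<close>
  define A where "A = 1 + 2 / \<delta> + real N"
  have A: "1 \<le> A" "2 / \<delta> \<le> A" "real N \<le> A" using assms(2) by (auto simp: A_def)
  have "real n \<le> A * (1 + real (c n))" for n
  proof (cases "N \<le> n")
    case True
    \<comment> \<open>At n = 0 the quotient is 0 by the convention for division by zero.\<close>
    have "n \<noteq> 0" using N[OF True] assms(2) by (intro notI) simp
    then have "real n \<le> 2 / \<delta> * real (c n)"
      using N[OF True] assms(2) by (simp add: field_simps)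
    also have "\<dots> \<le> A * (1 + real (c n))" using A by (intro mult_mono) auto
    finally show ?thesis .
  next
    case False
    then have "real n \<le> A * 1" using A by simp
    also have "\<dots> \<le> A * (1 + real (c n))" using A by (intro mult_left_mono) auto
    finally show ?thesis .
  qed
  then show ?thesis using A by blast
qed

text \<open>The zeros are summed on to the end of block \<open>j\<close>, while each one up to n
  costs at most q. As weights are at least 1, the weight of the zeros also bounds their
  number.\<close>

lemma sum_orbit_weight_upper:
  assumes x: "x \<in> nondyadic" and p: "0 < p" and n: "n \<le> ones_end x j"
  defines "C \<equiv> 2 powr p / (2 powr p - 1) * 2 powr p"
  shows "(\<Sum>k<n. orbit_weight p x k)
      \<le> C * (\<Sum>u = 1..j. (2 powr p) ^ zeros_length x u) + 2 powr p * real (digit_count x 1 n)"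
    and "real (digit_count x 0 n) \<le> C * (\<Sum>u = 1..j. (2 powr p) ^ zeros_length x u)"
proof -
  let ?z = "\<lambda>k. if digit x (Suc k) = 0 then orbit_weight p x k else 0"
  have "sum ?z {..<n} \<le> sum ?z {..<ones_end x j}"
    using n by (intro sum_mono2) (auto simp: orbit_weight_def)
  then have z: "sum ?z {..<n} \<le> C * (\<Sum>u = 1..j. (2 powr p) ^ zeros_length x u)"
    using sum_zeros_upper[OF x p, of j] unfolding C_def by linarith
  have "(\<Sum>k<n. orbit_weight p x k)
      \<le> (\<Sum>k<n. ?z k + 2 powr p * (if digit x (Suc k) = 1 then 1 else 0))"
  proof (intro sum_mono)
    fix k
    show "orbit_weight p x k \<le> ?z k + 2 powr p * (if digit x (Suc k) = 1 then 1 else 0)"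
      using digit_in[OF x, of k] orbit_weight_one_digit[OF x p, of k] by auto
  qed
  also have "\<dots> = sum ?z {..<n} + 2 powr p * real (digit_count x 1 n)"
    unfolding digit_count_eq_sum of_nat_sum sum.distrib sum_distrib_left
    by (intro arg_cong2[of _ _ _ _ "(+)"] sum.cong) auto
  finally show "(\<Sum>k<n. orbit_weight p x k)
      \<le> C * (\<Sum>u = 1..j. (2 powr p) ^ zeros_length x u) + 2 powr p * real (digit_count x 1 n)"
    using z by linarith
  have "real (digit_count x 0 n) \<le> sum ?z {..<n}"
    unfolding digit_count_eq_sum of_nat_sum
    by (intro sum_mono) (auto simp: orbit_weight_ge_1[OF x p])
  then show "real (digit_count x 0 n) \<le> C * (\<Sum>u = 1..j. (2 powr p) ^ zeros_length x u)"
    using z by linarith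
qed

lemma block_index_bounds:
  assumes "x \<in> nondyadic" "1 \<le> n" "n \<notin> K_set x 0"
  obtains i where "block_index x n = Suc i" "ones_end x i < n" "n \<le> ones_end x (Suc i)"
proof -
  have "1 \<le> block_index x n \<and> n \<in> J_set x (block_index x n) \<union> K_set x (block_index x n)"
    unfolding block_index_def by (rule theI'[OF ex1_block_index[OF assms]])
  moreover then obtain i where "block_index x n = Suc i" by (cases "block_index x n") auto
  ultimately show ?thesis
    by (intro that[of i]) (auto simp: J_set_def K_set_def J_block_def K_block_def)
qed

section \<open>Assembling the two comparisons\<close>

theorem theorem4p4:
  fixes p x :: real
  assumes "0 < p"
    and "x \<in> nondyadic"
    and "simply_normal x"
  shows "\<exists>c1 c2 d1 d2 :: real. 0 < c1 \<and> 0 < c2 \<and> 0 < d1 \<and> 0 < d2 \<and>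
    (\<forall>n::nat. 1 \<le> n \<longrightarrow>
      c1 * Lambda1 p x n \<le> (\<Sum>k = 1..n. 1 / ((doubling_map ^^ (k - 1)) x) powr p) \<and>
      (\<Sum>k = 1..n. 1 / ((doubling_map ^^ (k - 1)) x) powr p) \<le> c2 * Lambda1 p x n \<and>
      d1 * Lambda2 p x n \<le> 1 / real n * (\<Sum>k = 1..n. 1 / ((doubling_map ^^ (k - 1)) x) powr p) \<and>
      1 / real n * (\<Sum>k = 1..n. 1 / ((doubling_map ^^ (k - 1)) x) powr p) \<le> d2 * Lambda2 p x n)"
proof -
  note p = assms(1) and x = assms(2)
  define q where "q = 2 powr p"
  have q: "1 < q" using p by (simp add: q_def)
  have powq: "2 powr (p * real l) = q ^ l" for l
    by (simp add: q_def powr_powr flip: powr_realpow)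
  define S where "S n = (\<Sum>k<n. orbit_weight p x k)" for n
  have S: "(\<Sum>k = 1..n. 1 / ((doubling_map ^^ (k - 1)) x) powr p) = S n" for n
    unfolding S_def orbit_weight_def
    by (rule sum.reindex_bij_witness[of _ Suc "\<lambda>k. k - 1"]) auto
  \<comment> \<open>Simple normality enters only here: both digits have density 1/2.\<close>
  have dens: "\<exists>A\<ge>1. \<forall>n. real n \<le> A * (1 + real (digit_count x c n))" if "c = 0 \<or> c = 1" for c
    using assms(3) that unfolding simply_normal_def digit_count_def[symmetric]
    by (auto intro!: linear_bound_of_positive_density[of _ "1/2"])
  obtain A where A: "1 \<le> A" "\<And>n. real n \<le> A * (1 + real (digit_count x 0 n))"
    using dens[of 0] by auto
  obtain B where B: "1 \<le> B" "\<And>n. real n \<le> B * (1 + real (digit_count x 1 n))"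
    using dens[of 1] by auto
  define C where "C = q / (q - 1) * q"
  have C: "0 < C" using q by (simp add: C_def)
  \<comment> \<open>The summands pay for the zeros, for the ones after comparing their number with
    that of the zeros, and for the initial block of ones.\<close>
  define c2 where "c2 = C + q * A * (1 + C) + q * real (ones_length x 0)"
  have c2: "0 < c2" unfolding c2_def using C q A(1)
    by (intro add_pos_nonneg add_pos_pos mult_nonneg_nonneg mult_pos_pos) auto
  \<comment> \<open>Here both Lambda values are 1 and the average lies between 1 and q; this is why
    \<open>q\<close> is added to the last constant.\<close>
  have initial: "1 * Lambda1 p x n \<le> S n \<and> S n \<le> c2 * Lambda1 p x n \<and>
      1 / (2 * A) * Lambda2 p x n \<le> 1 / real n * S n \<and>
      1 / real n * S n \<le> (c2 * B + q) * Lambda2 p x n"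
    if n: "1 \<le> n" "n \<in> K_set x 0" for n
  proof -
    have n': "n \<le> ones_length x 0" using n by (simp add: K_set_def K_block_def)
    have lo: "real n \<le> S n"
      using sum_mono[of "{..<n}" "\<lambda>_. 1" "orbit_weight p x"] orbit_weight_ge_1[OF x p]
      by (simp add: S_def)
    have "digit x (Suc k) = 1" if "k < n" for k
      using n' that by (intro digit_ones_block[OF x, of 0]) auto
    then have up: "S n \<le> q * real n"
      using sum_mono[of "{..<n}" "orbit_weight p x" "\<lambda>_. q"] orbit_weight_one_digit[OF x p]
      by (simp add: S_def q_def mult.commute)
    have "q * real n \<le> q * real (ones_length x 0)" using n' q by simp
    also have "\<dots> \<le> c2" unfolding c2_def using C q A(1) by simp
    finally have 1: "S n \<le> c2" using up by linarith
    have 2: "1 \<le> 1 / real n * S n" "1 / real n * S n \<le> q"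
      using lo up n(1) by (auto simp: field_simps)
    have "1 / (2 * A) \<le> 1" "0 \<le> c2 * B" using A(1) B(1) c2 by auto
    then have "1 / (2 * A) \<le> 1 / real n * S n" "1 / real n * S n \<le> c2 * B + q"
      using 2 by linarith+
    moreover have "1 \<le> S n" using lo n(1) by linarith
    ultimately show ?thesis using n(2) 1 by (simp add: Lambda1_def Lambda2_def)
  qed
  have later: "1 * Lambda1 p x n \<le> S n \<and> S n \<le> c2 * Lambda1 p x n \<and>
      1 / (2 * A) * Lambda2 p x n \<le> 1 / real n * S n \<and>
      1 / real n * S n \<le> (c2 * B + q) * Lambda2 p x n"
    if n: "1 \<le> n" "n \<notin> K_set x 0" for n
  proof -
    obtain i where i: "block_index x n = Suc i" "ones_end x i < n" "n \<le> ones_end x (Suc i)"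
      using block_index_bounds[OF x n] .
    define G where "G = (\<Sum>u = 1..Suc i. q ^ zeros_length x u)"
    define L where "L = (\<Sum>u = 1..Suc i. zeros_length x u)"
    have Lam1: "Lambda1 p x n = G"
      using n(2) by (simp add: Lambda1_def i(1) G_def powq)
    have Lam2: "Lambda2 p x n = G / real L"
      using n(2) by (simp add: Lambda2_def i(1) G_def L_def powq)
    have "1 \<le> q ^ zeros_length x (Suc i)" using q by simp
    also have "\<dots> \<le> G"
      unfolding G_def using q by (intro member_le_sum) auto
    finally have G1: "1 \<le> G" .
    have L1: "1 \<le> L" using zeros_ones_length_pos(1)[OF x, of "Suc i"] by (simp add: L_def)
    have "(\<Sum>k<Suc (ones_end x i). orbit_weight p x k) \<le> S n"
      unfolding S_def using i(2) by (intro sum_mono2) (auto simp: orbit_weight_def)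
    then have lo: "G \<le> S n"
      using sum_orbit_weight_lower[OF x p, of i] unfolding G_def q_def by linarith
    have up': "S n \<le> C * G + q * real (digit_count x 1 n)" "real (digit_count x 0 n) \<le> C * G"
      using sum_orbit_weight_upper[OF x p i(3)] unfolding S_def C_def G_def q_def by simp_all
    have "real (digit_count x 1 n) \<le> real n" using digit_count_le by simp
    also have "\<dots> \<le> A * (1 + real (digit_count x 0 n))" by (rule A(2))
    \<comment> \<open>The summand 1 is absorbed by \<open>G\<close>, which is at least 1.\<close>
    also have "\<dots> \<le> A * (G + C * G)" using up'(2) G1 A(1) by (intro mult_left_mono) auto
    finally have "q * real (digit_count x 1 n) \<le> q * (A * (G + C * G))"
      using q by (intro mult_left_mono) auto
    then have "S n \<le> (C + q * A * (1 + C)) * G" using up'(1) by (simp add: algebra_simps)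
    also have "\<dots> \<le> c2 * G" unfolding c2_def using q G1 by (intro mult_right_mono) auto
    finally have up: "S n \<le> c2 * G" .
    \<comment> \<open>At most \<open>L\<close> zeros occur up to n, since n does not pass the end of
      block \<open>Suc i\<close>; the summand 1 is at most \<open>L\<close>, whence the factor
      2.\<close>
    have "real n \<le> A * (1 + real (digit_count x 0 n))" by (rule A(2))
    also have "\<dots> \<le> A * (real L + real L)"
      using A(1) L1 digit_count_mono[OF i(3), of x 0] unfolding digit_count_zeros(1)[OF x] L_def[symmetric]
      by (intro mult_left_mono add_mono) auto
    finally have nL: "real n \<le> 2 * A * real L" by simp
    \<comment> \<open>The density of ones is applied at the end of the block of zeros, possibly
      beyond n. The ones counted there number at most \<open>ones_end x i\<close>, which is less
      than n, so the summand 1 still fits.\<close>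
    have "real L \<le> real (zeros_end x (Suc i))"
      using digit_count_le[of x 0 "zeros_end x (Suc i)"] unfolding digit_count_zeros(2)[OF x] L_def
      by (simp only: of_nat_le_iff)
    also have "\<dots> \<le> B * (1 + real (digit_count x 1 (zeros_end x (Suc i))))" by (rule B(2))
    also have "\<dots> \<le> B * real n"
      using B(1) digit_count_ones[OF x, of i] i(2) by (intro mult_left_mono) (linarith, simp)
    finally have Ln: "real L \<le> B * real n" .
    have "1 / (2 * A) * (G / real L) = G / (2 * A * real L)" by simp
    also have "\<dots> \<le> G / real n"
      using nL n(1) G1 A(1) L1 by (intro divide_left_mono mult_pos_pos) auto
    also have "\<dots> \<le> 1 / real n * S n" using lo by (simp add: divide_right_mono)
    finally have 1: "1 / (2 * A) * (G / real L) \<le> 1 / real n * S n" .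
    have "1 / real n * S n \<le> c2 * G * (1 / real n)"
      using up by (simp add: divide_right_mono)
    also have "\<dots> \<le> c2 * G * (B / real L)"
      using c2 G1 Ln n(1) L1 by (intro mult_left_mono) (auto simp: field_simps)
    also have "\<dots> \<le> (c2 * B + q) * (G / real L)"
      using q G1 by (simp add: algebra_simps)
    finally have 2: "1 / real n * S n \<le> (c2 * B + q) * (G / real L)" .
    show ?thesis unfolding Lam1 Lam2 using lo up 1 2 by simp
  qed
  have "0 < c2 * B + q" "0 < 1 / (2 * A)" using c2 B(1) A(1) q by (auto intro!: add_pos_pos)
  moreover have "1 * Lambda1 p x n \<le> S n \<and> S n \<le> c2 * Lambda1 p x n \<and>
      1 / (2 * A) * Lambda2 p x n \<le> 1 / real n * S n \<and>
      1 / real n * S n \<le> (c2 * B + q) * Lambda2 p x n" if "1 \<le> n" for n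
    using initial[OF that] later[OF that] by (cases "n \<in> K_set x 0") simp_all
  ultimately show ?thesis
    unfolding S using c2 by (intro exI[of _ 1] exI[of _ c2] exI[of _ "1 / (2 * A)"] exI[of _ "c2 * B + q"]) simp
qed

end
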